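(* For every function $f\colon\{0,1\}^n\to\mathbb{R}$ and every $S\subseteq N$, we have $$\Phi_{\mathrm{B},\mathbf{p}}(f,S)=\sum_{T\subseteq N\setminus S}p_T^S\,\big(f(T\cup S)-f(T)\big),$$ where the coefficients $$p_T^S=\prod_{i\in T}p_i\prod_{i\in N\setminus(S\cup T)}(1-p_i)$$ satisfy the conditions $p_T^S\geqslant 0$ and $\sum_{T\subseteq N\setminus S}p_T^S=1$.
   Context: Let $n\geqslant 1$, $N=\{1,\ldots,n\}$, and $\mathbf{p}=(p_1,\ldots,p_n)\in\,]0,1[^n$. Boolean vectors $\mathbf{x}\in\{0,1\}^n$ are identified with subsets $T\subseteq N$ via $x_i=1\iff i\in T$; functions on $\{0,1\}^n$ are thus also set functions on $2^N$. For $T\subseteq N$ let $u_T(\mathbf{x})=\prod_{i\in T}x_i$ (with $u_\varnothing=1$). Let $w(S)=\prod_{i\in S}p_i\prod_{i\in N\setminus S}(1-p_i)$ for $S\subseteq N$. For $S\subseteq N$ let $V_S$ be the linear span of $\{u_T:T\subseteq S\}$, i.e., the functions $\{0,1\}^n\to\mathbb{R}$ depending only on the variables in $S$. The (weighted) best $S$-approximation of $f\colon\{0,1\}^n\to\mathbb{R}$ is the unique $f_{S,\mathbf{p}}\in V_S$ minimizing $\sum_{T\subseteq N}w(T)(f(T)-g(T))^2$ among all $g\in V_S$. The weighted Banzhaf influence index is $$\Phi_{\mathrm{B},\mathbf{p}}(f,S)=f_{S,\mathbf{p}}(S)-f_{S,\mathbf{p}}(\varnothing).$$ *)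

theory Defs
  imports "HOL-Analysis.Analysis" "HOL-Library.Function_Algebras"
begin

text \<open>
  The index set \<open>N\<close> is the universe of a finite type \<open>'n\<close> (nonempty, with
  \<open>n = CARD('n)\<close> arbitrary), and a Boolean vector is identified with the subset of
  indices at which it equals \<open>1\<close>. A function on \<open>{0,1}^n\<close> thus
  has type \<open>'n set \<Rightarrow> real\<close>, and such functions form a real vector space under the
  pointwise operations.
\<close>

interpretation fun_vs: vector_space "\<lambda>(c::real) (g::'a \<Rightarrow> real) x. c * g x"
  by unfold_locales (auto simp: fun_eq_iff algebra_simps)

text \<open>\<open>u_T(x) = \<Prod>i\<in>T. x_i\<close>, where \<open>x_i = of_bool (i \<in> X)\<close> for the vector with support \<open>X\<close>.\<close>

definition u :: "'n::finite set \<Rightarrow> 'n set \<Rightarrow> real" where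
  "u T X = (\<Prod>i\<in>T. of_bool (i \<in> X))"

definition V :: "'n::finite set \<Rightarrow> ('n set \<Rightarrow> real) set" where
  "V S = fun_vs.span {u T |T. T \<subseteq> S}"

definition w :: "('n::finite \<Rightarrow> real) \<Rightarrow> 'n set \<Rightarrow> real" where
  "w p S = (\<Prod>i\<in>S. p i) * (\<Prod>i\<in>UNIV - S. 1 - p i)"

definition sq_err :: "('n::finite \<Rightarrow> real) \<Rightarrow> ('n set \<Rightarrow> real) \<Rightarrow> ('n set \<Rightarrow> real) \<Rightarrow> real" where
  "sq_err p f g = (\<Sum>T\<in>UNIV. w p T * (f T - g T)\<^sup>2)"

text \<open>
  The description is meaningful whenever \<open>0 < p i < 1\<close> for all \<open>i\<close>: all weights are then
  positive, so that \<open>sq_err p f\<close> has exactly one minimizer on the subspace \<open>V S\<close>.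
\<close>

definition best_approx ::
    "('n::finite \<Rightarrow> real) \<Rightarrow> ('n set \<Rightarrow> real) \<Rightarrow> 'n set \<Rightarrow> ('n set \<Rightarrow> real)" where
  "best_approx p f S = (THE g. is_arg_min (sq_err p f) (\<lambda>h. h \<in> V S) g)"

definition banzhaf_influence ::
    "('n::finite \<Rightarrow> real) \<Rightarrow> ('n set \<Rightarrow> real) \<Rightarrow> 'n set \<Rightarrow> real" where
  "banzhaf_influence p f S = best_approx p f S S - best_approx p f S {}"

definition coeff_p :: "('n::finite \<Rightarrow> real) \<Rightarrow> 'n set \<Rightarrow> 'n set \<Rightarrow> real" where
  "coeff_p p S T = (\<Prod>i\<in>T. p i) * (\<Prod>i\<in>UNIV - (S \<union> T). 1 - p i)"

end

theory Submission
  imports Defs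
begin

text \<open>
  A function lies in \<open>V S\<close> iff it depends only on \<open>X \<inter> S\<close>. The weight \<open>w\<close> is a product of
  a weight on \<open>S\<close> and the probability weight \<open>coeff_p p S\<close> on the complement of \<open>S\<close>, so
  averaging \<open>f\<close> over the coordinates outside \<open>S\<close> is the orthogonal projection onto \<open>V S\<close>:
  the bias-variance decomposition on each fibre shows that it is the unique minimizer.
  The influence index is then the difference of this conditional mean at \<open>S\<close> and at \<open>{}\<close>.
\<close>

lemma u_eq_of_bool: "u T X = of_bool (T \<subseteq> X)"
  unfolding u_def by (cases "T \<subseteq> X") (auto intro!: prod.neutral)

lemma sum_fun_eval: "sum F A x = (\<Sum>a\<in>A. F a x)"
  for F :: "'a \<Rightarrow> 'b \<Rightarrow> 'c::comm_monoid_add"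
  by (induction A rule: infinite_finite_induct) auto

text \<open>For \<open>R \<subseteq> S\<close>, \<open>u R\<close> is the sum of the indicators of
  the traces \<open>Q\<close> with \<open>R \<subseteq> Q \<subseteq> S\<close>. Solving for the
  term \<open>Q = R\<close> leaves only strictly larger traces, so the induction runs downwards from
  \<open>S\<close>.\<close>

lemma trace_indicator_in_V:
  fixes S :: "'n::finite set"
  assumes "R \<subseteq> S"
  shows "(\<lambda>X. of_bool (X \<inter> S = R)) \<in> V S"
  using assms
proof (induction "card (S - R)" arbitrary: R rule: less_induct)
  case less
  let ?e = "\<lambda>Q X. of_bool (X \<inter> S = Q) :: real"
  let ?Qs = "{Q. R \<subset> Q \<and> Q \<subseteq> S}"
  have "?e R = u R - (\<Sum>Q\<in>?Qs. ?e Q)"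
  proof
    fix X
    have "(\<Sum>Q\<in>?Qs. ?e Q X) = (\<Sum>Q\<in>?Qs. if X \<inter> S = Q then 1 else 0)"
      by (intro sum.cong) auto
    also have "\<dots> = of_bool (R \<subset> X \<inter> S)"
      by (subst sum.delta') auto
    finally show "?e R X = (u R - (\<Sum>Q\<in>?Qs. ?e Q)) X"
      using less.prems by (auto simp: sum_fun_eval u_eq_of_bool)
  qed
  moreover have "?e Q \<in> V S" if "Q \<in> ?Qs" for Q
    using that by (intro less.hyps psubset_card_mono) auto
  moreover have "u R \<in> V S"
    unfolding V_def using less.prems by (auto intro: fun_vs.span_base)
  ultimately show ?case
    unfolding V_def by (auto intro!: fun_vs.span_diff fun_vs.span_sum)
qed

lemma mem_V_iff: "g \<in> V S \<longleftrightarrow> (\<forall>X. g X = g (X \<inter> S))"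
  for g :: "'n::finite set \<Rightarrow> real"
proof
  assume "g \<in> V S"
  then show "\<forall>X. g X = g (X \<inter> S)"
    unfolding V_def
    by (induction rule: fun_vs.span_induct_alt) (auto simp: u_eq_of_bool)
next
  assume g: "\<forall>X. g X = g (X \<inter> S)"
  \<comment> \<open>Exactly one summand is nonzero at \<open>X\<close>, the one whose
    \<open>R\<close> is the trace of \<open>X\<close> on \<open>S\<close>.\<close>
  have "g = (\<Sum>R\<in>Pow S. (\<lambda>X. g R * of_bool (X \<inter> S = R)))"
  proof
    fix X
    have "(\<Sum>R\<in>Pow S. g R * of_bool (X \<inter> S = R)) = (\<Sum>R\<in>Pow S. if X \<inter> S = R then g R else 0)"
      by (intro sum.cong) auto
    also have "\<dots> = g X"
      using g by (subst sum.delta') auto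
    finally show "g X = (\<Sum>R\<in>Pow S. (\<lambda>X. g R * of_bool (X \<inter> S = R))) X"
      by (simp add: sum_fun_eval)
  qed
  also have "\<dots> \<in> V S"
    using trace_indicator_in_V[of _ S] unfolding V_def
    by (intro fun_vs.span_sum fun_vs.span_scale) auto
  finally show "g \<in> V S" .
qed

text \<open>Expanding the product of the factors \<open>p i + (1 - p i) = 1\<close> over the
  complement of \<open>S\<close> gives one term for each \<open>T\<close>.\<close>

lemma sum_coeff_p: "(\<Sum>T\<in>Pow (UNIV - S). coeff_p p S T) = 1"
proof -
  have "(\<Sum>T\<in>Pow (UNIV - S). coeff_p p S T)
      = (\<Sum>T\<in>Pow (UNIV - S). (\<Prod>i\<in>T. p i) * (\<Prod>i\<in>(UNIV - S) - T. 1 - p i))"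
    unfolding coeff_p_def by (intro sum.cong refl) (simp add: Diff_Un Diff_eq Int_assoc)
  also have "\<dots> = (\<Prod>i\<in>UNIV - S. p i + (1 - p i))"
    by (subst prod_add) auto
  finally show ?thesis by simp
qed

lemma coeff_p_pos:
  assumes "\<And>i. 0 < p i \<and> p i < 1"
  shows "0 < coeff_p p S T"
  unfolding coeff_p_def using assms by (intro mult_pos_pos prod_pos) (auto simp: less_diff_eq)

text \<open>The factor \<open>coeff_p p (UNIV - S) A\<close> is the product weight of
  \<open>A\<close> inside \<open>S\<close>, because the complement of
  \<open>(UNIV - S) \<union> A\<close> is \<open>S - A\<close>.\<close>

lemma w_Un:
  assumes "A \<subseteq> S" "T \<subseteq> UNIV - S"
  shows "w p (T \<union> A) = coeff_p p (UNIV - S) A * coeff_p p S T"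
proof -
  have "(\<Prod>i\<in>T \<union> A. p i) = (\<Prod>i\<in>T. p i) * (\<Prod>i\<in>A. p i)"
    using assms by (intro prod.union_disjoint) auto
  moreover have "UNIV - (T \<union> A) = (UNIV - (S \<union> T)) \<union> (UNIV - ((UNIV - S) \<union> A))"
    using assms by auto
  then have "(\<Prod>i\<in>UNIV - (T \<union> A). 1 - p i)
      = (\<Prod>i\<in>UNIV - (S \<union> T). 1 - p i) * (\<Prod>i\<in>UNIV - ((UNIV - S) \<union> A). 1 - p i)"
    by (simp only:) (intro prod.union_disjoint, auto)
  ultimately show ?thesis
    unfolding w_def coeff_p_def by simp
qed

lemma sum_UNIV_split:
  fixes F :: "'n::finite set \<Rightarrow> 'a::comm_monoid_add"
  shows "(\<Sum>X\<in>UNIV. F X) = (\<Sum>A\<in>Pow S. \<Sum>T\<in>Pow (UNIV - S). F (T \<union> A))"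
proof -
  have "(\<Sum>A\<in>Pow S. \<Sum>T\<in>Pow (UNIV - S). F (T \<union> A))
      = (\<Sum>(A, T)\<in>Pow S \<times> Pow (UNIV - S). F (T \<union> A))"
    by (rule sum.cartesian_product)
  also have "\<dots> = (\<Sum>X\<in>UNIV. F X)"
    by (rule sum.reindex_bij_witness[where i = "\<lambda>X. (X \<inter> S, X - S)" and j = "\<lambda>(A, T). T \<union> A"])
      (auto simp: Un_commute)
  finally show ?thesis by simp
qed

text \<open>For independent coordinates with success probabilities \<open>p i\<close>, this is the
  conditional expectation of \<open>f\<close> given the coordinates in \<open>S\<close>.\<close>

definition cond_mean :: "('n::finite \<Rightarrow> real) \<Rightarrow> ('n set \<Rightarrow> real) \<Rightarrow> 'n set \<Rightarrow> 'n set \<Rightarrow> real" where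
  "cond_mean p f S X = (\<Sum>T\<in>Pow (UNIV - S). coeff_p p S T * f (T \<union> (X \<inter> S)))"

lemma cond_mean_in_V: "cond_mean p f S \<in> V S"
  by (simp add: mem_V_iff cond_mean_def)

lemma weighted_square_deviation:
  fixes c y :: "'a \<Rightarrow> real"
  assumes "sum c I = 1" and m: "m = (\<Sum>i\<in>I. c i * y i)"
  shows "(\<Sum>i\<in>I. c i * (y i - h)\<^sup>2) = (\<Sum>i\<in>I. c i * (y i - m)\<^sup>2) + (m - h)\<^sup>2"
proof -
  have "(\<Sum>i\<in>I. c i * (y i - h)\<^sup>2)
      = (\<Sum>i\<in>I. c i * (y i - m)\<^sup>2 + 2 * (m - h) * (c i * y i) + ((m - h)\<^sup>2 - 2 * (m - h) * m) * c i)"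
    by (intro sum.cong refl) (simp add: power2_eq_square algebra_simps)
  also have "\<dots> = (\<Sum>i\<in>I. c i * (y i - m)\<^sup>2) + 2 * (m - h) * m + ((m - h)\<^sup>2 - 2 * (m - h) * m) * 1"
    unfolding sum.distrib sum_distrib_left[symmetric] assms(1) m[symmetric] ..
  finally show ?thesis by simp
qed

text \<open>This is Pythagoras for the projection onto \<open>V S\<close>: the excess error is a
  weighted squared distance, which yields both minimality and uniqueness.\<close>

lemma sq_err_decomposition:
  assumes "h \<in> V S"
  shows "sq_err p f h = sq_err p f (cond_mean p f S)
    + (\<Sum>A\<in>Pow S. coeff_p p (UNIV - S) A * (cond_mean p f S A - h A)\<^sup>2)"
proof -
  let ?m = "cond_mean p f S"
  let ?a = "coeff_p p (UNIV - S)" and ?c = "coeff_p p S"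
  have fibre: "sq_err p f g = (\<Sum>A\<in>Pow S. ?a A * (\<Sum>T\<in>Pow (UNIV - S). ?c T * (f (T \<union> A) - g A)\<^sup>2))"
    if "g \<in> V S" for g
  proof -
    have g: "g (T \<union> A) = g A" if "A \<subseteq> S" "T \<subseteq> UNIV - S" for A T
    proof -
      have "(T \<union> A) \<inter> S = A" using that by auto
      with \<open>g \<in> V S\<close> show ?thesis unfolding mem_V_iff by metis
    qed
    show ?thesis
      unfolding sq_err_def sum_UNIV_split[of _ S] sum_distrib_left
      by (intro sum.cong refl) (simp add: w_Un g mult.assoc)
  qed
  have "(\<Sum>T\<in>Pow (UNIV - S). ?c T * (f (T \<union> A) - h A)\<^sup>2)
      = (\<Sum>T\<in>Pow (UNIV - S). ?c T * (f (T \<union> A) - ?m A)\<^sup>2) + (?m A - h A)\<^sup>2"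
    if "A \<in> Pow S" for A
    using that
    by (intro weighted_square_deviation sum_coeff_p) (simp add: cond_mean_def Int_absorb2)
  then show ?thesis
    by (simp add: fibre assms cond_mean_in_V distrib_left sum.distrib)
qed

lemma best_approx_eq_cond_mean:
  assumes "\<And>i. 0 < p i \<and> p i < 1"
  shows "best_approx p f S = cond_mean p f S"
  unfolding best_approx_def
proof (rule the_equality)
  let ?m = "cond_mean p f S"
  have nonneg: "0 \<le> coeff_p p (UNIV - S) A * (?m A - h A)\<^sup>2" for h A
    using coeff_p_pos[of p, OF assms] by (simp add: less_imp_le)
  show "is_arg_min (sq_err p f) (\<lambda>h. h \<in> V S) ?m"
    unfolding is_arg_min_linorder
  proof (intro conjI allI impI cond_mean_in_V)
    fix h assume "h \<in> V S"
    from sq_err_decomposition[OF this, of p f] show "sq_err p f ?m \<le> sq_err p f h"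
      using nonneg by (simp add: sum_nonneg)
  qed
  fix g assume "is_arg_min (sq_err p f) (\<lambda>h. h \<in> V S) g"
  then have g: "g \<in> V S" and "sq_err p f g \<le> sq_err p f ?m"
    by (auto simp: is_arg_min_linorder cond_mean_in_V)
  then have "(\<Sum>A\<in>Pow S. coeff_p p (UNIV - S) A * (?m A - g A)\<^sup>2) = 0"
    using nonneg sq_err_decomposition[OF g, of p f] by (intro antisym sum_nonneg) auto
  then have "\<forall>A\<in>Pow S. coeff_p p (UNIV - S) A * (?m A - g A)\<^sup>2 = 0"
    using nonneg by (subst (asm) sum_nonneg_eq_0_iff) auto
  \<comment> \<open>The weights are strictly positive, so a vanishing term forces equal
    values.\<close>
  then have eq: "?m A = g A" if "A \<subseteq> S" for A
    using that coeff_p_pos[of p, OF assms, of "UNIV - S" A] by force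
  show "g = ?m"
  proof
    fix X
    have "g X = g (X \<inter> S)" using g by (simp add: mem_V_iff)
    also have "\<dots> = ?m (X \<inter> S)" by (simp add: eq)
    also have "\<dots> = ?m X" by (simp add: cond_mean_def)
    finally show "g X = ?m X" .
  qed
qed

theorem proposition3p6:
  fixes p :: "'n::finite \<Rightarrow> real" and f :: "'n set \<Rightarrow> real" and S :: "'n set"
  assumes "\<And>i. 0 < p i \<and> p i < 1"
  shows "banzhaf_influence p f S = (\<Sum>T\<in>Pow (UNIV - S). coeff_p p S T * (f (T \<union> S) - f T))
    \<and> (\<forall>T\<in>Pow (UNIV - S). coeff_p p S T \<ge> 0)
    \<and> (\<Sum>T\<in>Pow (UNIV - S). coeff_p p S T) = 1"
  \<comment> \<open>The arguments \<open>S\<close> and \<open>{}\<close> have traces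
    \<open>S\<close> and \<open>{}\<close>, so the two conditional means are sums over the same
    \<open>T\<close> and subtract termwise.\<close>
  using coeff_p_pos[of p, OF assms] sum_coeff_p[of p S]
  by (simp add: banzhaf_influence_def best_approx_eq_cond_mean[of p, OF assms] cond_mean_def
      sum_subtractf[symmetric] right_diff_distrib less_imp_le)

end
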